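(* Let $0<s<1$. Assume that $u\in\mathcal{L}_{2s}\cap C^2(\mathbb{R}^n)$ attains its maximum at a point $\tilde x\in\mathbb{R}^n$. Let $$C_0:=\left(\int_{B_1^c(0)}\frac{1}{|y|^{n+2s}}\,dy\right)^{-1}>0.$$ Then for any $r>0$, $$\frac{C_0}{C_{n,s}}\,r^{2s}\big\{(-\Delta)^su(\tilde x)-\Delta u(\tilde x)\big\}+C_0r^{2s}\int_{B_r^c(\tilde x)}\frac{u(y)}{|\tilde x-y|^{n+2s}}\,dy\ \ge\ u(\tilde x),$$ and $$C_0r^{2s}\int_{B_r^c(\tilde x)}\frac{1}{|\tilde x-y|^{n+2s}}\,dy=1.$$
   Context: $B_r^c(x)$ denotes the complement in $\mathbb{R}^n$ of the ball $B_r(x)$ of radius $r$ centered at $x$. The space $\mathcal{L}_{2s}$ is $$\mathcal{L}_{2s}=\Big\{u\in L^1_{loc}(\mathbb{R}^n)\ \Big|\ \int_{\mathbb{R}^n}\frac{|u(x)|}{1+|x|^{n+2s}}\,dx<+\infty\Big\}.$$ The fractional Laplacian is $$(-\Delta)^s u(x)=C_{n,s}\,\mathrm{P.V.}\int_{\mathbb{R}^n}\frac{u(x)-u(y)}{|x-y|^{n+2s}}\,dy=C_{n,s}\lim_{\epsilon\to0}\int_{\mathbb{R}^n\setminus B_\epsilon(x)}\frac{u(x)-u(y)}{|x-y|^{n+2s}}\,dy,$$ where $C_{n,s}>0$ is the usual normalization constant (the same constant appears in the claim). $\Delta$ is the classical Laplacian. *)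

theory Defs
  imports "HOL-Analysis.Analysis"
begin

(* L^1_loc(R^n): integrability on every compact set. *)
definition locally_L1 :: "(real^'n \<Rightarrow> real) set" where
  "locally_L1 = {u. \<forall>K. compact K \<longrightarrow> set_integrable lebesgue K u}"

(* The space written \<L>_{2s} in the literature; the argument is s, not 2s. *)
definition L2s_space :: "real \<Rightarrow> (real^'n \<Rightarrow> real) set" where
  "L2s_space s = {u \<in> locally_L1.
     integrable lebesgue (\<lambda>x. \<bar>u x\<bar> / (1 + norm x powr (real CARD('n) + 2 * s)))}"

definition has_partial :: "'n \<Rightarrow> (real^'n \<Rightarrow> real) \<Rightarrow> bool" where
  "has_partial i u \<longleftrightarrow>
     (\<forall>x. (\<lambda>t. u (x + t *\<^sub>R axis i 1)) field_differentiable at 0)"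

definition partial :: "'n \<Rightarrow> (real^'n \<Rightarrow> real) \<Rightarrow> real^'n \<Rightarrow> real" where
  "partial i u x = deriv (\<lambda>t. u (x + t *\<^sub>R axis i 1)) 0"

(* C^2(R^n): all partial derivatives of order at most 2 exist everywhere and are continuous. *)
definition C2_space :: "(real^'n \<Rightarrow> real) set" where
  "C2_space = {u. continuous_on UNIV u \<and>
     (\<forall>i. has_partial i u \<and> continuous_on UNIV (partial i u) \<and>
       (\<forall>j. has_partial j (partial i u) \<and> continuous_on UNIV (partial j (partial i u))))}"

definition laplacian :: "(real^'n \<Rightarrow> real) \<Rightarrow> real^'n \<Rightarrow> real" where
  "laplacian u x = (\<Sum>i\<in>UNIV. partial i (partial i u) x)"

(* The usual normalization, for which the Fourier symbol of the operator is |xi|^(2s):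
   C_{n,s} = 4^s Gamma(n/2 + s) / (pi^(n/2) |Gamma(-s)|). *)
definition frac_const :: "nat \<Rightarrow> real \<Rightarrow> real" where
  "frac_const n s =
     4 powr s * Gamma (real n / 2 + s) / (pi powr (real n / 2) * \<bar>Gamma (- s)\<bar>)"

(* The principal value is the limit as epsilon decreases to 0; Lim has an unspecified value
   where that limit does not exist. *)
definition frac_laplacian :: "real \<Rightarrow> (real^'n \<Rightarrow> real) \<Rightarrow> real^'n \<Rightarrow> real" where
  "frac_laplacian s u x = frac_const CARD('n) s *
     Lim (at_right 0) (\<lambda>\<epsilon>. LINT y : - ball x \<epsilon> | lebesgue.
       (u x - u y) / norm (x - y) powr (real CARD('n) + 2 * s))"

end

theory Submission
  imports Defs
begin

text \<open>
  Write \<open>n\<close> for the dimension, \<open>p = n + 2s\<close> and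
  \<open>F(y) = (u(xt) - u(y)) / |xt - y|^p\<close>. Since \<open>xt\<close> is a maximum point, \<open>F \<ge> 0\<close>, so discarding the
  ball \<open>B_r(xt)\<close> from the domain of the singular integral can only lower it:
  \<open>(-\<Delta>)^s u(xt) / C_{n,s} = \<integral> F \<ge> \<integral>_{B_r^c} F = u(xt) \<integral>_{B_r^c} |xt - y|^{-p} - \<integral>_{B_r^c} u(y) |xt - y|^{-p}\<close>.
  By scaling, the first integral on the right is \<open>r^{-2s} / C0\<close>, which is the asserted identity.
  Multiplying by \<open>C0 r^{2s}\<close>, and using \<open>\<Delta> u(xt) \<le> 0\<close>, gives the asserted inequality.

  The work lies in showing that these integrals are genuine and that the principal value exists,
  which amounts to \<open>F\<close> being integrable on all of \<open>\<real>^n\<close>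
  (the principal value is then \<open>\<integral> F\<close>, by dominated convergence). Away from \<open>xt\<close> this is the decay condition
  in \<open>\<L>_{2s}\<close> (lemma \<open>L2s_tail_integrable\<close>). Near \<open>xt\<close> the gradient of \<open>u\<close> vanishes, so
  \<open>u(xt) - u(y)\<close> is of order \<open>|xt - y|^2\<close> (lemma \<open>C2_quadratic_bound_at_max\<close>), and
  \<open>|xt - y|^{2 - p}\<close> is integrable near \<open>xt\<close> because \<open>p < n + 2\<close>
  (lemma \<open>quadratic_singularity_integrable\<close>).
\<close>

section \<open>Integrability of powers of the distance\<close>

text \<open>
  The indicator of \<open>A\<close> times \<open>\<bar>f\<bar>\<close> is dominated by the sum of the step functions \<open>c k\<close> on
  \<open>ball a (R k)\<close>, and the volume of that ball is a multiple of \<open>R k ^ DIM('a)\<close>. With radii in geometric progression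
  this reduces integrability of a power of the distance to a geometric series, both at a point and
  at infinity, without polar coordinates.
\<close>
lemma integrable_on_ball_cover:
  fixes f :: "'a::euclidean_space \<Rightarrow> real" and c R :: "nat \<Rightarrow> real"
  assumes f [measurable]: "f \<in> borel_measurable borel" and A [measurable]: "A \<in> sets borel"
    and cover: "\<And>y. y \<in> A \<Longrightarrow> \<exists>k. dist a y < R k \<and> \<bar>f y\<bar> \<le> c k"
    and nonneg: "\<And>k. 0 \<le> c k" "\<And>k. 0 \<le> R k"
    and sum: "summable (\<lambda>k. c k * R k ^ DIM('a))"
  shows "set_integrable lborel A f"
  unfolding set_integrable_def
proof (rule integrableI_bounded)
  let ?v = "unit_ball_vol (real DIM('a))"
  have "ennreal (norm (indicator A y *\<^sub>R f y)) \<le> (\<Sum>k. ennreal (c k) * indicator (ball a (R k)) y)" for y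
  proof (cases "y \<in> A")
    case True
    then obtain k where k: "dist a y < R k" "\<bar>f y\<bar> \<le> c k" using cover by blast
    have "ennreal (norm (indicator A y *\<^sub>R f y)) \<le> ennreal (c k) * indicator (ball a (R k)) y"
      using k True by (simp add: ennreal_leI)
    also have "\<dots> = (\<Sum>j\<in>{k}. ennreal (c j) * indicator (ball a (R j)) y)"
      by (simp only: sum.insert finite.emptyI empty_iff not_False_eq_True sum.empty add_0_right)
    also have "\<dots> \<le> (\<Sum>k. ennreal (c k) * indicator (ball a (R k)) y)"
      by (rule sum_le_suminf) auto
    finally show ?thesis .
  qed simp
  then have "(\<integral>\<^sup>+y. ennreal (norm (indicator A y *\<^sub>R f y)) \<partial>lborel)
      \<le> (\<integral>\<^sup>+y. (\<Sum>k. ennreal (c k) * indicator (ball a (R k)) y) \<partial>lborel)"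
    by (intro nn_integral_mono)
  also have "\<dots> = (\<Sum>k. ennreal (c k) * emeasure lborel (ball a (R k)))"
    by (subst nn_integral_suminf)
      (auto simp: nn_integral_cmult_indicator
        intro!: borel_measurable_times_ennreal borel_measurable_indicator)
  also have "\<dots> = (\<Sum>k. ennreal (?v * (c k * R k ^ DIM('a))))"
    by (intro suminf_cong)
      (simp add: emeasure_ball nonneg ennreal_mult' [symmetric] mult_ac)
  also have "\<dots> < \<infinity>"
  proof -
    have "(\<Sum>k. ennreal (?v * (c k * R k ^ DIM('a))))
        = ennreal (\<Sum>k. ?v * (c k * R k ^ DIM('a)))"
      by (rule suminf_ennreal2) (auto intro!: mult_nonneg_nonneg zero_le_power nonneg summable_mult sum)
    then show ?thesis by simp
  qed
  finally show "(\<integral>\<^sup>+y. ennreal (norm (indicator A y *\<^sub>R f y)) \<partial>lborel) < \<infinity>" .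
qed simp

lemma dyadic_bracket:
  fixes x :: real
  assumes "1 \<le> x"
  obtains k :: nat where "2 ^ k \<le> x" "x < 2 ^ Suc k"
proof -
  \<comment> \<open>The least such exponent is not \<open>0\<close>, and its predecessor is the one wanted.\<close>
  define n where "n = (LEAST n. x < 2 ^ n)"
  obtain m where "x < 2 ^ m" using real_arch_pow[of 2 x] by auto
  then have n: "x < 2 ^ n" unfolding n_def by (rule LeastI)
  then obtain k where k: "n = Suc k" using assms by (cases n) auto
  have "\<not> x < 2 ^ k" using not_less_Least[of k "\<lambda>n. x < 2 ^ n"] k n_def by simp
  then show ?thesis using that[of k] n k by (simp add: not_less)
qed

text \<open>
  On the shell \<open>\<rho> 2^k \<le> |a - y| < \<rho> 2^(k+1)\<close> the kernel is at most \<open>(\<rho> 2^k)^(-p)\<close>, and the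
  volume is of order \<open>2^(k n)\<close>: the ratio of the resulting geometric series is \<open>2^(n-p) < 1\<close>.
\<close>
lemma kernel_integrable_outside_ball:
  fixes a :: "'a::euclidean_space"
  assumes p: "real DIM('a) < p" and \<rho>: "0 < \<rho>"
  shows "set_integrable lborel (- ball a \<rho>) (\<lambda>y. 1 / norm (a - y) powr p)"
proof (rule integrable_on_ball_cover[where a = a and R = "\<lambda>k. \<rho> * 2 ^ Suc k"
      and c = "\<lambda>k. 1 / (\<rho> * 2 ^ k) powr p"])
  fix y assume y: "y \<in> - ball a \<rho>"
  then have "1 \<le> dist a y / \<rho>" using \<rho> by (simp add: field_simps)
  then obtain k where k: "2 ^ k \<le> dist a y / \<rho>" "dist a y / \<rho> < 2 ^ Suc k"
    by (rule dyadic_bracket)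
  have le: "\<rho> * 2 ^ k \<le> norm (a - y)" using k \<rho> by (simp add: field_simps dist_norm)
  have pos: "0 < \<rho> * 2 ^ k" using \<rho> by simp
  have "(\<rho> * 2 ^ k) powr p \<le> norm (a - y) powr p"
    using le pos p by (intro powr_mono2) auto
  moreover have "0 < (\<rho> * 2 ^ k) powr p" using \<rho> by simp
  ultimately have "\<bar>1 / norm (a - y) powr p\<bar> \<le> 1 / (\<rho> * 2 ^ k) powr p"
    by (simp add: frac_le)
  moreover have "dist a y < \<rho> * 2 ^ Suc k" using k \<rho> by (simp add: field_simps)
  ultimately show "\<exists>k. dist a y < \<rho> * 2 ^ Suc k \<and> \<bar>1 / norm (a - y) powr p\<bar> \<le> 1 / (\<rho> * 2 ^ k) powr p"
    by blast
next
  let ?n = "DIM('a)"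
  have eq: "1 / (\<rho> * 2 ^ k) powr p * (\<rho> * 2 ^ Suc k) ^ ?n
      = (1 / \<rho> powr p * (2 * \<rho>) ^ ?n) * (2 powr (real ?n - p)) ^ k" for k
  proof -
    have "(2 powr (real ?n - p)) ^ k = (2 ^ k) ^ ?n / (2 ^ k) powr p"
      by (simp add: powr_realpow[symmetric] powr_powr powr_diff[symmetric] algebra_simps del: power_Suc)
    then show ?thesis using \<rho> by (simp add: powr_mult power_mult_distrib field_simps)
  qed
  have "2 powr (real ?n - p) < 2 powr 0" using p by (subst powr_less_cancel_iff) auto
  then show "summable (\<lambda>k. 1 / (\<rho> * 2 ^ k) powr p * (\<rho> * 2 ^ Suc k) ^ ?n)"
    unfolding eq by (intro summable_mult summable_geometric) simp
qed (use \<rho> in auto)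

text \<open>
  On the shell \<open>2^(-k-1) < |a - y| \<le> 2^(-k)\<close> the quotient is at most a multiple of \<open>2^(k(p-2))\<close>,
  and the volume is of order \<open>2^(-k n)\<close>: the ratio is now \<open>2^(p-n-2) < 1\<close>. Numerator and
  denominator are bounded separately because \<open>p - 2\<close> may have either sign.
\<close>
lemma quadratic_singularity_integrable:
  fixes a :: "'a::euclidean_space" and f :: "'a \<Rightarrow> real"
  assumes f [measurable]: "f \<in> borel_measurable borel"
    and p: "0 \<le> p" "p < real DIM('a) + 2" and M: "0 \<le> M"
    and quad: "\<And>y. y \<in> ball a 1 \<Longrightarrow> \<bar>f y\<bar> \<le> M * norm (a - y) ^ 2"
  shows "set_integrable lborel (ball a 1) (\<lambda>y. f y / norm (a - y) powr p)"
proof (rule integrable_on_ball_cover[where a = a and R = "\<lambda>k. 2 / 2 ^ k"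
      and c = "\<lambda>k. M * (1 / 2 ^ k) ^ 2 * (2 ^ Suc k) powr p"])
  fix y assume y: "y \<in> ball a 1"
  show "\<exists>k. dist a y < 2 / 2 ^ k
      \<and> \<bar>f y / norm (a - y) powr p\<bar> \<le> M * (1 / 2 ^ k) ^ 2 * (2 ^ Suc k) powr p"
  proof (cases "y = a")
    case True
    \<comment> \<open>Here the quotient is \<open>0\<close>, because division by \<open>0\<close> gives \<open>0\<close>.\<close>
    then show ?thesis using M by (intro exI[of _ 0]) auto
  next
    case False
    define d where "d = norm (a - y)"
    have d: "0 < d" "d < 1" using False y by (auto simp: d_def dist_norm)
    then have "1 \<le> 1 / d" by simp
    then obtain k where "2 ^ k \<le> 1 / d" "1 / d < 2 ^ Suc k" by (rule dyadic_bracket)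
    then have k: "d \<le> 1 / 2 ^ k" "1 / d \<le> 2 ^ Suc k" using d by (auto simp: field_simps)
    have "\<bar>f y / d powr p\<bar> = \<bar>f y\<bar> * (1 / d) powr p"
      using d by (simp add: powr_divide)
    also have "\<dots> \<le> (M * (1 / 2 ^ k) ^ 2) * (2 ^ Suc k) powr p"
    proof (rule mult_mono)
      have "\<bar>f y\<bar> \<le> M * d ^ 2" using quad[OF y] by (simp add: d_def)
      also have "\<dots> \<le> M * (1 / 2 ^ k) ^ 2"
        using k d M by (intro mult_left_mono power_mono) auto
      finally show "\<bar>f y\<bar> \<le> M * (1 / 2 ^ k) ^ 2" .
      show "(1 / d) powr p \<le> (2 ^ Suc k) powr p"
        using k d p by (intro powr_mono2) auto
    qed (use M in auto)
    finally have "\<bar>f y / norm (a - y) powr p\<bar> \<le> M * (1 / 2 ^ k) ^ 2 * (2 ^ Suc k) powr p"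
      by (simp add: d_def)
    moreover have "1 / 2 ^ k < (2 / 2 ^ k :: real)" by (simp add: divide_strict_right_mono)
    then have "dist a y < 2 / 2 ^ k" using k by (simp add: d_def dist_norm)
    ultimately show ?thesis by blast
  qed
next
  let ?n = "DIM('a)"
  have eq: "M * (1 / 2 ^ k) ^ 2 * (2 ^ Suc k) powr p * (2 / 2 ^ k) ^ ?n
      = (M * 2 powr p * 2 ^ ?n) * (2 powr (p - (real ?n + 2))) ^ k" for k
  proof -
    have "(2 powr (p - (real ?n + 2))) ^ k = (2 ^ k) powr p / ((2 ^ k) ^ ?n * (2 ^ k) ^ 2)"
      by (simp add: powr_realpow[symmetric] powr_powr powr_diff[symmetric] powr_add[symmetric]
          algebra_simps del: power_Suc)
    then show ?thesis by (simp add: powr_mult power_divide field_simps)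
  qed
  have "2 powr (p - (real ?n + 2)) < 2 powr 0" using p by (subst powr_less_cancel_iff) auto
  then show "summable (\<lambda>k. M * (1 / 2 ^ k) ^ 2 * (2 ^ Suc k) powr p * (2 / 2 ^ k) ^ ?n)"
    unfolding eq by (intro summable_mult summable_geometric) simp
qed (use M in auto)

section \<open>The kernel integral outside a ball\<close>

text \<open>The substitution \<open>y = a + r x\<close>, whose Jacobian is \<open>r^n\<close>.\<close>
lemma kernel_integral_scaling:
  fixes a :: "'a::euclidean_space"
  assumes r: "0 < r"
  shows "r powr (p - real DIM('a)) * (LINT y : - ball a r | lborel. 1 / norm (a - y) powr p)
    = (LINT y : - ball (0 :: 'a) 1 | lborel. 1 / norm y powr p)"
proof -
  let ?h = "\<lambda>y. indicator (- ball a r) y *\<^sub>R (1 / norm (a - y) powr p)"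
  let ?n = "DIM('a)"
  have "integral\<^sup>L lborel ?h
      = integral\<^sup>L (density (distr lborel borel (\<lambda>x. a + r *\<^sub>R x)) (\<lambda>_. \<bar>r\<bar> ^ ?n)) ?h"
    using lborel_affine[of r a] r by simp
  also have "\<dots> = r ^ ?n * integral\<^sup>L lborel (\<lambda>x. ?h (a + r *\<^sub>R x))"
    using r by (simp add: integral_density integral_distr
        flip: times_divide_eq_right integral_mult_right_zero)
  also have "(\<lambda>x. ?h (a + r *\<^sub>R x)) =
      (\<lambda>x. (1 / r powr p) * (indicator (- ball 0 1) x *\<^sub>R (1 / norm x powr p)))"
  proof
    fix x
    have "a + r *\<^sub>R x \<in> - ball a r \<longleftrightarrow> x \<in> - ball 0 1"
      using r by (simp add: dist_norm)
    then show "?h (a + r *\<^sub>R x) = (1 / r powr p) * (indicator (- ball 0 1) x *\<^sub>R (1 / norm x powr p))"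
      using r by (simp add: powr_mult indicator_def)
  qed
  also have "integral\<^sup>L lborel \<dots>
      = (1 / r powr p) * (LINT y : - ball (0 :: 'a) 1 | lborel. 1 / norm y powr p)"
    unfolding set_lebesgue_integral_def by (rule integral_mult_right_zero)
  finally have "(LINT y : - ball a r | lborel. 1 / norm (a - y) powr p)
      = r ^ ?n * ((1 / r powr p) * (LINT y : - ball (0 :: 'a) 1 | lborel. 1 / norm y powr p))"
    unfolding set_lebesgue_integral_def .
  then show ?thesis
    using r by (simp add: powr_diff powr_realpow)
qed

lemma kernel_integral_pos:
  assumes "real DIM('a) < p"
  shows "0 < (LINT y : - ball (0 :: 'a::euclidean_space) 1 | lborel. 1 / norm y powr p)"
proof -
  let ?h = "\<lambda>y::'a. indicator (- ball 0 1) y *\<^sub>R (1 / norm y powr p)"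
  have int: "integrable lborel ?h"
    using kernel_integrable_outside_ball[OF assms zero_less_one, of 0]
    by (simp add: set_integrable_def)
  have "integral\<^sup>L lborel ?h \<noteq> 0"
  proof
    assume "integral\<^sup>L lborel ?h = 0"
    then have "AE y in lborel. ?h y = 0"
      using integral_nonneg_eq_0_iff_AE[OF int] by simp
    then have "AE y in lborel. y \<in> ball (0::'a) 1"
      by eventually_elim (auto simp: indicator_def split: if_splits)
    then have "AE y in lebesgue. y \<in> ball (0::'a) 1" by (rule AE_completion)
    then have "negligible (- ball (0::'a) 1)"
      by (simp add: negligible_iff_null_sets AE_iff_null_sets Compl_eq)
    then have "negligible (- cball (0::'a) 1)" by (rule negligible_subset) auto
    then have "- cball (0::'a) 1 = {}"
      using open_not_negligible[of "- cball (0::'a) 1"] by blast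
    then have "cball (0::'a) 1 = UNIV" by blast
    then have "bounded (UNIV :: 'a set)" using bounded_cball[of "0::'a" 1] by metis
    then show False using not_bounded_UNIV by blast
  qed
  moreover have "0 \<le> integral\<^sup>L lborel ?h" by (intro Bochner_Integration.integral_nonneg) auto
  ultimately show ?thesis unfolding set_lebesgue_integral_def by linarith
qed

section \<open>Second-order behaviour at a maximum point\<close>

text \<open>
  Partial derivatives are defined by differentiating at parameter \<open>0\<close> of each axis-parallel line;
  moving the base point gives the derivative at every other parameter.
\<close>
lemma has_partial_deriv_along_axis:
  assumes "has_partial i f"
  shows "((\<lambda>t. f (x + t *\<^sub>R axis i 1)) has_real_derivative partial i f (x + t *\<^sub>R axis i 1)) (at t)"
proof -
  have "((\<lambda>h. f ((x + t *\<^sub>R axis i 1) + h *\<^sub>R axis i 1)) has_real_derivative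
      partial i f (x + t *\<^sub>R axis i 1)) (at 0)"
    using assms unfolding has_partial_def partial_def
    by (simp add: field_differentiable_derivI)
  then have "((\<lambda>h. f (x + (h + t) *\<^sub>R axis i 1)) has_real_derivative
      partial i f (x + t *\<^sub>R axis i 1)) (at 0)"
    by (simp add: algebra_simps)
  then show ?thesis
    using DERIV_shift[of "\<lambda>t. f (x + t *\<^sub>R axis i 1)" _ 0 t] by simp
qed

text \<open>
  The point \<open>x\<close> is changed into \<open>y\<close> one coordinate at a time. All intermediate segments are
  parallel to an axis and lie in the box spanned by \<open>x\<close> and \<open>y\<close>, so the one-dimensional mean value
  inequality applies to each of them.
\<close>
lemma bounded_partials_imp_Lipschitz:
  fixes f :: "real^'n \<Rightarrow> real"
  assumes part: "\<And>i. has_partial i f" and K: "0 \<le> K"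
    and bound: "\<And>i z. (\<And>j. \<bar>z $ j - x $ j\<bar> \<le> \<bar>y $ j - x $ j\<bar>) \<Longrightarrow> \<bar>partial i f z\<bar> \<le> K"
  shows "\<bar>f y - f x\<bar> \<le> real CARD('n) * K * norm (y - x)"
proof -
  define w where "w S = (\<chi> i. if i \<in> S then y $ i else x $ i)" for S
  have "\<bar>f (w S) - f x\<bar> \<le> real (card S) * (K * norm (y - x))" if "finite S" for S
    using that
  proof (induction S rule: finite_induct)
    case empty
    have "w {} = x" by (simp add: w_def vec_eq_iff)
    then show ?case by simp
  next
    case (insert i S)
    let ?d = "y $ i - x $ i"
    let ?g = "\<lambda>t. f (w S + t *\<^sub>R axis i 1)"
    have step: "w (insert i S) = w S + ?d *\<^sub>R axis i 1"
      using insert.hyps by (auto simp: w_def vec_eq_iff axis_def)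
    have "norm (?g ?d - ?g 0) \<le> K * norm (?d - 0)"
    proof (rule field_differentiable_bound[where S = "closed_segment 0 ?d"])
      fix t assume t: "t \<in> closed_segment 0 ?d"
      show "(?g has_field_derivative partial i f (w S + t *\<^sub>R axis i 1)) (at t within closed_segment 0 ?d)"
        by (rule has_field_derivative_at_within[OF has_partial_deriv_along_axis[OF part]])
      have "\<bar>t\<bar> \<le> \<bar>?d\<bar>" using t by (auto simp: closed_segment_eq_real_ivl split: if_splits)
      then show "norm (partial i f (w S + t *\<^sub>R axis i 1)) \<le> K"
        unfolding real_norm_def using insert.hyps by (intro bound) (auto simp: w_def axis_def)
    qed auto
    also have "\<dots> \<le> K * norm (y - x)"
      using component_le_norm_cart[of "y - x" i] K by (simp add: mult_left_mono)
    finally have "\<bar>f (w (insert i S)) - f (w S)\<bar> \<le> K * norm (y - x)" by (simp add: step)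
    with insert.IH have "\<bar>f (w (insert i S)) - f x\<bar> \<le> real (card S) * (K * norm (y - x)) + K * norm (y - x)"
      by linarith
    then show ?case using insert.hyps by (simp add: distrib_right)
  qed
  from this[of UNIV] show ?thesis by (simp add: w_def mult_ac)
qed

lemma partial_zero_at_max:
  assumes "has_partial i u" "\<forall>x. u x \<le> u a"
  shows "partial i u a = 0"
  using has_partial_deriv_along_axis[OF assms(1), of a 0] assms(2)
  by (intro DERIV_local_max[where d = 1 and x = 0 and f = "\<lambda>t. u (a + t *\<^sub>R axis i 1)"]) auto

text \<open>
  If the second derivative along an axis were positive, the first one, which vanishes at the
  maximum, would be positive just to the right of it, and \<open>u\<close> would increase there.
\<close>
lemma second_partial_nonpos_at_max:
  assumes u: "has_partial i u" and u': "has_partial i (partial i u)" and max: "\<forall>x. u x \<le> u a"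
  shows "partial i (partial i u) a \<le> 0"
proof (rule ccontr)
  let ?e = "\<lambda>t. a + t *\<^sub>R axis i (1::real)"
  assume "\<not> ?thesis"
  then obtain d where d: "0 < d" "\<forall>h>0. h < d \<longrightarrow> partial i u (?e 0) < partial i u (?e (0 + h))"
    using DERIV_pos_inc_right[OF has_partial_deriv_along_axis[OF u', of a 0]] by auto
  have "u (?e 0) < u (?e (d / 2))"
  proof (rule DERIV_pos_imp_increasing_open[where f = "\<lambda>t. u (?e t)"])
    show "\<exists>y. ((\<lambda>t. u (?e t)) has_real_derivative y) (at t) \<and> 0 < y" if "0 < t" "t < d / 2" for t
      using d that partial_zero_at_max[OF u max]
      by (intro exI[of _ "partial i u (?e t)"] conjI has_partial_deriv_along_axis[OF u]) auto
    show "continuous_on {0..d / 2} (\<lambda>t. u (?e t))"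
      by (intro continuous_at_imp_continuous_on ballI
          DERIV_isCont[OF has_partial_deriv_along_axis[OF u]])
  qed (use d in auto)
  then show False using max[rule_format, of "?e (d / 2)"] by simp
qed

lemma laplacian_nonpos_at_max:
  assumes "u \<in> C2_space" "\<forall>x. u x \<le> u a"
  shows "laplacian u a \<le> 0"
  using assms unfolding laplacian_def C2_space_def
  by (intro sum_nonpos second_partial_nonpos_at_max) auto

text \<open>
  The second partial derivatives are bounded on a compact box around \<open>a\<close>, and the first ones
  vanish at \<open>a\<close>. The Lipschitz estimate, applied to the first partial derivatives, shows that they
  are of order \<open>|y - a|\<close> on the box spanned by \<open>a\<close> and \<open>y\<close>; applied to \<open>u\<close>, it supplies the second
  factor \<open>|y - a|\<close>.
\<close>
lemma C2_quadratic_bound_at_max: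
  fixes u :: "real^'n \<Rightarrow> real"
  assumes u: "u \<in> C2_space" and max: "\<forall>x. u x \<le> u a"
  obtains M where "0 \<le> M" "\<And>y. y \<in> ball a 1 \<Longrightarrow> \<bar>u a - u y\<bar> \<le> M * norm (a - y) ^ 2"
proof -
  let ?n = "real CARD('n)"
  let ?B = "cbox (a - 1) (a + 1)"
  let ?D = "\<lambda>z. \<Sum>i\<in>UNIV. \<Sum>j\<in>UNIV. \<bar>partial j (partial i u) z\<bar>"
  have part: "has_partial i u" "has_partial j (partial i u)"
    and cont: "continuous_on UNIV (partial j (partial i u))" for i j
    using u by (auto simp: C2_space_def)
  have "continuous_on ?B ?D"
    by (intro continuous_intros continuous_on_subset[OF cont]) auto
  then have "bounded (?D ` ?B)"
    by (intro compact_imp_bounded compact_continuous_image compact_cbox)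
  then obtain K where K: "\<And>z. z \<in> ?B \<Longrightarrow> \<bar>?D z\<bar> \<le> K" "0 < K"
    unfolding bounded_pos by auto
  have second: "\<bar>partial j (partial i u) z\<bar> \<le> K" if "z \<in> ?B" for i j z
  proof -
    have "\<bar>partial j (partial i u) z\<bar> \<le> (\<Sum>j\<in>UNIV. \<bar>partial j (partial i u) z\<bar>)"
      by (rule member_le_sum) auto
    also have "\<dots> \<le> ?D z"
      by (rule member_le_sum[of i UNIV "\<lambda>i. \<Sum>j\<in>UNIV. \<bar>partial j (partial i u) z\<bar>"])
        (auto intro: sum_nonneg)
    also have "\<dots> \<le> K" using K(1)[OF that] by simp
    finally show ?thesis .
  qed
  have inB: "z \<in> ?B" if "\<And>j. \<bar>z $ j - a $ j\<bar> \<le> \<bar>y $ j - a $ j\<bar>" "norm (y - a) \<le> 1" for y z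
    unfolding mem_box_cart
  proof
    fix j
    have "\<bar>z $ j - a $ j\<bar> \<le> 1"
      using that(1)[of j] component_le_norm_cart[of "y - a" j] that(2) by simp
    then show "(a - 1) $ j \<le> z $ j \<and> z $ j \<le> (a + 1) $ j" by (simp add: abs_le_iff)
  qed
  show thesis
  proof
    show "0 \<le> ?n * (?n * K * ?n)" using K by simp
    fix y assume "y \<in> ball a 1"
    then have y: "norm (y - a) \<le> 1" by (simp add: dist_norm norm_minus_commute)
    have first: "\<bar>partial i u z\<bar> \<le> ?n * K * (?n * norm (y - a))"
      if z: "\<And>j. \<bar>z $ j - a $ j\<bar> \<le> \<bar>y $ j - a $ j\<bar>" for i z
    proof -
      have "\<bar>partial i u z - partial i u a\<bar> \<le> ?n * K * norm (z - a)"
      proof (rule bounded_partials_imp_Lipschitz)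
        fix j v assume "\<And>j. \<bar>v $ j - a $ j\<bar> \<le> \<bar>z $ j - a $ j\<bar>"
        then show "\<bar>partial j (partial i u) v\<bar> \<le> K"
          using z by (intro second inB[OF _ y]) (meson order_trans)
      qed (use part K in auto)
      moreover have "norm (z - a) \<le> ?n * norm (y - a)"
      proof -
        have "norm (z - a) \<le> (\<Sum>j\<in>UNIV. \<bar>(z - a) $ j\<bar>)" by (rule norm_le_l1_cart)
        also have "\<dots> \<le> (\<Sum>j\<in>(UNIV::'n set). norm (y - a))"
          using z component_le_norm_cart[of "y - a"] by (intro sum_mono) (auto intro: order_trans)
        finally show ?thesis by simp
      qed
      then have "?n * K * norm (z - a) \<le> ?n * K * (?n * norm (y - a))"
        using K by (intro mult_left_mono) auto
      ultimately show ?thesis using partial_zero_at_max[OF part(1) max, of i] by linarith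
    qed
    have "\<bar>u y - u a\<bar> \<le> ?n * (?n * K * (?n * norm (y - a))) * norm (y - a)"
      by (rule bounded_partials_imp_Lipschitz) (use part first K in auto)
    then show "\<bar>u a - u y\<bar> \<le> ?n * (?n * K * ?n) * norm (a - y) ^ 2"
      by (simp add: abs_minus_commute norm_minus_commute power2_eq_square mult_ac)
  qed
qed

section \<open>Tails, the normalization constant and the principal value\<close>

text \<open>
  Compares the weight of \<open>\<L>_{2s}\<close>, which is centred at the origin, with the kernel centred at \<open>a\<close>.
\<close>
lemma one_plus_powr_le_shifted:
  fixes a y :: "'a::real_normed_vector"
  assumes "0 \<le> p" "1 \<le> norm (a - y)"
  shows "1 + norm y powr p \<le> (1 + (1 + norm a) powr p) * norm (a - y) powr p"
proof -
  have "norm y \<le> norm a + norm (a - y)" by (metis add.commute norm_triangle_sub norm_minus_commute)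
  also have "\<dots> \<le> (1 + norm a) * norm (a - y)"
    using mult_left_mono[OF assms(2), of "norm a"] by (simp add: algebra_simps)
  finally have "norm y powr p \<le> ((1 + norm a) * norm (a - y)) powr p"
    using assms by (intro powr_mono2) auto
  moreover have "1 \<le> norm (a - y) powr p" using assms by (intro ge_one_powr_ge_zero) auto
  ultimately have "1 + norm y powr p
      \<le> norm (a - y) powr p + (1 + norm a) powr p * norm (a - y) powr p"
    by (simp add: powr_mult)
  then show ?thesis by (simp add: distrib_right)
qed

lemma L2s_tail_integrable:
  fixes u :: "real^'n \<Rightarrow> real"
  assumes s: "0 < s" and u: "u \<in> L2s_space s" and meas [measurable]: "u \<in> borel_measurable borel"
  shows "set_integrable lborel (- ball a 1) (\<lambda>y. u y / norm (a - y) powr (real CARD('n) + 2 * s))"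
proof -
  define p where "p = real CARD('n) + 2 * s"
  define c where "c = 1 + (1 + norm a) powr p"
  have p: "0 \<le> p" using s by (simp add: p_def)
  have c: "0 < c" by (simp add: c_def add_pos_nonneg)
  have "integrable lebesgue (\<lambda>x. \<bar>u x\<bar> / (1 + norm x powr p))"
    using u by (simp add: L2s_space_def p_def)
  then have "integrable lborel (\<lambda>x. \<bar>u x\<bar> / (1 + norm x powr p))"
    by (simp add: integrable_completion)
  then have "integrable lborel (\<lambda>x. c * (\<bar>u x\<bar> / (1 + norm x powr p)))"
    by (intro integrable_mult_right)
  then have "set_integrable lborel (- ball a 1) (\<lambda>y. u y / norm (a - y) powr p)"
    unfolding set_integrable_def
  proof (rule Bochner_Integration.integrable_bound)
    show "AE y in lborel. norm (indicator (- ball a 1) y *\<^sub>R (u y / norm (a - y) powr p))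
        \<le> norm (c * (\<bar>u y\<bar> / (1 + norm y powr p)))"
    proof (rule AE_I2)
      fix y
      show "norm (indicator (- ball a 1) y *\<^sub>R (u y / norm (a - y) powr p))
        \<le> norm (c * (\<bar>u y\<bar> / (1 + norm y powr p)))"
      proof (cases "y \<in> - ball a 1")
        case True
        then have far: "1 \<le> norm (a - y)" by (simp add: dist_norm)
        then have pos: "0 < norm (a - y) powr p" by auto
        have pos': "0 < 1 + norm y powr p" by (simp add: add_pos_nonneg)
        have "1 / norm (a - y) powr p \<le> c / (1 + norm y powr p)"
          using one_plus_powr_le_shifted[OF p far] pos pos' by (simp add: c_def divide_simps)
        from mult_left_mono[OF this abs_ge_zero[of "u y"]] show ?thesis
          using True c pos' by (simp add: abs_mult mult_ac)
      qed simp
    qed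
  qed simp
  then show ?thesis by (simp add: p_def)
qed

lemma frac_const_pos:
  assumes "0 < n" "0 < s" "s < 1"
  shows "0 < frac_const n s"
proof -
  have "- s \<notin> \<int>\<^sub>\<le>\<^sub>0"
  proof
    assume "- s \<in> \<int>\<^sub>\<le>\<^sub>0"
    then obtain k where "s = real k" by (auto elim!: nonpos_Ints_cases')
    then show False using assms by simp
  qed
  then have "Gamma (- s) \<noteq> 0" by (simp add: Gamma_eq_zero_iff)
  then show ?thesis using assms unfolding frac_const_def
    by (intro divide_pos_pos mult_pos_pos Gamma_real_pos) auto
qed

text \<open>
  Dominated convergence: each \<open>y \<noteq> a\<close> eventually lies outside the excluded ball. The centre itself
  never does, and \<open>F a = 0\<close> makes the convergence hold there too.
\<close>
lemma integral_outside_shrinking_ball: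
  fixes F :: "'a::euclidean_space \<Rightarrow> real"
  assumes int: "integrable lborel F" and zero: "F a = 0"
  shows "((\<lambda>\<epsilon>. LINT y : - ball a \<epsilon> | lborel. F y) \<longlongrightarrow> integral\<^sup>L lborel F) (at_right 0)"
proof (rule tendsto_at_right_sequentially[OF zero_less_one])
  fix S :: "nat \<Rightarrow> real"
  assume S: "\<And>n. 0 < S n" "S \<longlonglongrightarrow> 0"
  have [measurable]: "F \<in> borel_measurable borel" using int by simp
  show "(\<lambda>n. LINT y : - ball a (S n) | lborel. F y) \<longlonglongrightarrow> integral\<^sup>L lborel F"
    unfolding set_lebesgue_integral_def
  proof (rule integral_dominated_convergence[where w = "\<lambda>y. norm (F y)"])
    show "AE y in lborel. (\<lambda>n. indicator (- ball a (S n)) y *\<^sub>R F y) \<longlonglongrightarrow> F y"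
    proof (rule AE_I2)
      fix y
      show "(\<lambda>n. indicator (- ball a (S n)) y *\<^sub>R F y) \<longlonglongrightarrow> F y"
      proof (cases "y = a")
        case True
        then show ?thesis using zero by simp
      next
        case False
        then have "eventually (\<lambda>n. S n < dist a y) sequentially"
          using order_tendstoD(2)[OF S(2)] by simp
        then have "eventually (\<lambda>n. indicator (- ball a (S n)) y *\<^sub>R F y = F y) sequentially"
          by eventually_elim simp
        then show ?thesis by (rule tendsto_eventually)
      qed
    qed
  qed (use int in \<open>auto simp: indicator_def\<close>)
qed

text \<open>
  For Borel integrands the completed measure gives the same integral; scaling, ball volumes and
  measurability are more convenient for \<open>lborel\<close>.
\<close>
lemma set_integral_lebesgue_eq_lborel:
  fixes f :: "'a::euclidean_space \<Rightarrow> real"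
  assumes [measurable]: "f \<in> borel_measurable borel" "A \<in> sets borel"
  shows "(LINT y : A | lebesgue. f y) = (LINT y : A | lborel. f y)"
  unfolding set_lebesgue_integral_def by (rule integral_completion) simp

section \<open>The inequality at a maximum point\<close>

theorem lemma2p1:
  fixes u :: "real^'n \<Rightarrow> real" and xt :: "real^'n" and s C\<^sub>0 :: real
  assumes s: "0 < s" "s < 1"
    and u: "u \<in> L2s_space s \<inter> C2_space"
    and max: "\<forall>x. u x \<le> u xt"
    and C0: "C\<^sub>0 = inverse (LINT y : - ball (0 :: real^'n) 1 | lebesgue.
                1 / norm y powr (real CARD('n) + 2 * s))"
  shows "C\<^sub>0 > 0 \<and>
    (\<forall>r>0.
       C\<^sub>0 / frac_const CARD('n) s * r powr (2 * s) * (frac_laplacian s u xt - laplacian u xt)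
         + C\<^sub>0 * r powr (2 * s) *
             (LINT y : - ball xt r | lebesgue. u y / norm (xt - y) powr (real CARD('n) + 2 * s))
         \<ge> u xt
       \<and> C\<^sub>0 * r powr (2 * s) *
             (LINT y : - ball xt r | lebesgue. 1 / norm (xt - y) powr (real CARD('n) + 2 * s)) = 1)"
proof -
  define p where "p = real CARD('n) + 2 * s"
  define F where "F y = (u xt - u y) / norm (xt - y) powr p" for y
  let ?k = "\<lambda>y. 1 / norm (xt - y) powr p"
  let ?C = "frac_const CARD('n) s"
  have p: "0 \<le> p" "real DIM(real^'n) < p" "p < real DIM(real^'n) + 2"
    using s by (auto simp: p_def)
  have uL: "u \<in> L2s_space s" and uC: "u \<in> C2_space" using u by auto
  have [measurable]: "u \<in> borel_measurable borel"
    using uC by (intro borel_measurable_continuous_onI) (simp add: C2_space_def)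
  have [measurable]: "F \<in> borel_measurable borel" unfolding F_def by measurable

  have kernel: "set_integrable lborel (- ball xt r) ?k" if "0 < r" for r
    using p that by (intro kernel_integrable_outside_ball)
  obtain M where M: "0 \<le> M" "\<And>y. y \<in> ball xt 1 \<Longrightarrow> \<bar>u xt - u y\<bar> \<le> M * norm (xt - y) ^ 2"
    using C2_quadratic_bound_at_max[OF uC max] by blast
  have near: "set_integrable lborel (ball xt 1) F"
    unfolding F_def by (rule quadratic_singularity_integrable) (use p M in auto)
  have "set_integrable lborel (- ball xt 1) (\<lambda>y. u xt * ?k y - u y / norm (xt - y) powr p)"
    using L2s_tail_integrable[OF s(1) uL, of xt] kernel[of 1]
    by (intro set_integral_diff set_integrable_mult_right) (auto simp: p_def)
  then have "set_integrable lborel (- ball xt 1) F"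
    unfolding F_def by (simp add: diff_divide_distrib)
  then have "set_integrable lborel (ball xt 1 \<union> - ball xt 1) F"
    by (intro set_integrable_Un near) auto
  then have F_int: "integrable lborel F"
    by (simp add: set_integrable_def Compl_partition)
  have F_nonneg: "0 \<le> F y" for y using max by (simp add: F_def)

  have "frac_laplacian s u xt = ?C * Lim (at_right 0) (\<lambda>\<epsilon>. LINT y : - ball xt \<epsilon> | lborel. F y)"
    unfolding frac_laplacian_def p_def[symmetric] F_def[symmetric]
    by (subst set_integral_lebesgue_eq_lborel) auto
  also have "Lim (at_right 0) (\<lambda>\<epsilon>. LINT y : - ball xt \<epsilon> | lborel. F y) = integral\<^sup>L lborel F"
    using integral_outside_shrinking_ball[OF F_int, of xt]
    by (intro tendsto_Lim) (auto simp: F_def)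
  finally have frac: "frac_laplacian s u xt = ?C * integral\<^sup>L lborel F" .

  have C: "0 < ?C" using s by (intro frac_const_pos) auto
  have C0': "C\<^sub>0 = inverse (LINT y : - ball (0 :: real^'n) 1 | lborel. 1 / norm y powr p)"
    unfolding C0 p_def[symmetric] by (subst set_integral_lebesgue_eq_lborel) auto
  have pos: "0 < (LINT y : - ball (0 :: real^'n) 1 | lborel. 1 / norm y powr p)"
    using p by (intro kernel_integral_pos)
  then have C0_pos: "0 < C\<^sub>0" by (simp add: C0')
  have total: "C\<^sub>0 * r powr (2 * s) * (LINT y : - ball xt r | lborel. ?k y) = 1" if "0 < r" for r
  proof -
    have "r powr (2 * s) * (LINT y : - ball xt r | lborel. ?k y)
        = (LINT y : - ball (0 :: real^'n) 1 | lborel. 1 / norm y powr p)"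
      using kernel_integral_scaling[OF that, of p xt] by (simp add: p_def)
    then show ?thesis using pos by (simp add: C0' mult.assoc)
  qed

  have ineq: "u xt \<le> C\<^sub>0 / ?C * r powr (2 * s) * (frac_laplacian s u xt - laplacian u xt)
      + C\<^sub>0 * r powr (2 * s) * (LINT y : - ball xt r | lborel. u y / norm (xt - y) powr p)"
    if r: "0 < r" for r
  proof -
    let ?c = "C\<^sub>0 * r powr (2 * s)"
    have c: "0 < ?c" using C0_pos r by simp
    \<comment> \<open>Cutting out \<open>ball xt r\<close> removes only a nonnegative part of \<open>\<integral> F\<close>.\<close>
    have F_tail: "set_integrable lborel (- ball xt r) F"
      using F_int unfolding set_integrable_def by (intro integrable_mult_indicator) auto
    have "(LINT y : - ball xt r | lborel. u y / norm (xt - y) powr p)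
        = (LINT y : - ball xt r | lborel. u xt * ?k y - F y)"
      unfolding F_def by (simp add: diff_divide_distrib)
    also have "\<dots> = (LINT y : - ball xt r | lborel. u xt * ?k y) - (LINT y : - ball xt r | lborel. F y)"
      using kernel[OF r] F_tail by (intro set_integral_diff set_integrable_mult_right)
    also have "(LINT y : - ball xt r | lborel. u xt * ?k y)
        = u xt * (LINT y : - ball xt r | lborel. ?k y)"
      by (rule set_integral_mult_right)
    finally have split: "(LINT y : - ball xt r | lborel. u y / norm (xt - y) powr p)
        = u xt * (LINT y : - ball xt r | lborel. ?k y) - (LINT y : - ball xt r | lborel. F y)" .
    have "(LINT y : - ball xt r | lborel. F y) \<le> integral\<^sup>L lborel F"
      using F_int F_tail F_nonneg unfolding set_lebesgue_integral_def set_integrable_def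
      by (intro integral_mono) (auto simp: indicator_def)
    with split have tail: "u xt * (LINT y : - ball xt r | lborel. ?k y) - integral\<^sup>L lborel F
        \<le> (LINT y : - ball xt r | lborel. u y / norm (xt - y) powr p)"
      by linarith
    have "integral\<^sup>L lborel F \<le> (frac_laplacian s u xt - laplacian u xt) / ?C"
      using laplacian_nonpos_at_max[OF uC max] C by (simp add: frac field_simps)
    with tail have "u xt * (LINT y : - ball xt r | lborel. ?k y)
        \<le> (frac_laplacian s u xt - laplacian u xt) / ?C
          + (LINT y : - ball xt r | lborel. u y / norm (xt - y) powr p)"
      by linarith
    from mult_left_mono[OF this less_imp_le[OF c]]
    have "(?c * (LINT y : - ball xt r | lborel. ?k y)) * u xt
        \<le> ?c * ((frac_laplacian s u xt - laplacian u xt) / ?C)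
          + ?c * (LINT y : - ball xt r | lborel. u y / norm (xt - y) powr p)"
      by (simp only: distrib_left mult_ac)
    then show ?thesis
      unfolding total[OF r] by (simp add: mult_ac)
  qed
  show ?thesis
    unfolding p_def[symmetric]
    using C0_pos ineq total by (simp add: set_integral_lebesgue_eq_lborel)
qed

end
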